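(* Let $G$ be an abelian group and $R$ a commutative ring with $1$ such that either $R$ has no torsion elements or, if $R$ has $p$-torsion elements for a prime $p$, then $p$ does not divide the order of any element of $G$. Let $\sigma$ and $\tau$ be two different $R$-algebra endomorphisms of $RG$. If there exists $b\in RG$ such that $\tau(b)-\sigma(b)\in\mathcal{U}(RG)$, then every $R$-linear $(\sigma,\tau)$-derivation $\delta$ of $RG$ is of the form $$\delta=(\tau(b)-\sigma(b))^{-1}\,\delta(b)\,(\tau-\sigma).$$
   Context: $\mathcal{U}(RG)$ is the unit group of $RG$. An element $r\neq0$ of $R$ is $p$-torsion if $pr=0$; $R$ has no torsion elements if its additive group is torsion-free. An $R$-linear $(\sigma,\tau)$-derivation of $RG$ is an $R$-linear map $\delta:RG\to RG$ with $\delta(ac)=\delta(a)\tau(c)+\sigma(a)\delta(c)$ for all $a,c\in RG$. The displayed formula means $\delta(a)=(\tau(b)-\sigma(b))^{-1}\delta(b)(\tau(a)-\sigma(a))$ for all $a\in RG$. *)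

theory Defs
  imports Complex_Main "HOL-Library.Poly_Mapping" "HOL-Computational_Algebra.Primes"
begin

text \<open>
  The group ring \<open>RG\<close> is the ring of finitely supported functions \<open>'g \<Rightarrow>\<^sub>0 'r\<close> with the convolution
  product of \<^theory>\<open>HOL-Library.Poly_Mapping\<close>. The abelian group \<open>G\<close> is written additively, so the
  group element \<open>g\<close> is embedded as \<open>Poly_Mapping.single g 1\<close>, and
  \<open>single g 1 * single h 1 = single (g + h) 1\<close>.
\<close>
type_synonym ('r, 'g) group_ring = "'g \<Rightarrow>\<^sub>0 'r"

definition gr_scale :: "'r::comm_ring_1 \<Rightarrow> ('r, 'g::ab_group_add) group_ring \<Rightarrow> ('r, 'g) group_ring"
  where "gr_scale r x = Poly_Mapping.map ((*) r) x"

lemma lookup_gr_scale: "Poly_Mapping.lookup (gr_scale r x) g = r * Poly_Mapping.lookup x g"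
  by (simp add: gr_scale_def Poly_Mapping.map.rep_eq when_def)

text \<open>Library linearity \<^const>\<open>module_hom\<close> includes the module axioms; they do hold here.\<close>
lemma module_gr_scale: "module (gr_scale :: 'r::comm_ring_1 \<Rightarrow> ('r, 'g::ab_group_add) group_ring \<Rightarrow> _)"
  by unfold_locales
    (auto intro!: poly_mapping_eqI simp: lookup_gr_scale lookup_add algebra_simps)

definition gr_algebra_endo ::
    "(('r::comm_ring_1, 'g::ab_group_add) group_ring \<Rightarrow> ('r, 'g) group_ring) \<Rightarrow> bool"
  where "gr_algebra_endo f \<longleftrightarrow>
    module_hom gr_scale gr_scale f \<and> (\<forall>x y. f (x * y) = f x * f y) \<and> f 1 = 1"

definition twisted_derivation ::
    "(('r::comm_ring_1, 'g::ab_group_add) group_ring \<Rightarrow> ('r, 'g) group_ring) \<Rightarrow>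
     (('r, 'g) group_ring \<Rightarrow> ('r, 'g) group_ring) \<Rightarrow>
     (('r, 'g) group_ring \<Rightarrow> ('r, 'g) group_ring) \<Rightarrow> bool"
  where "twisted_derivation \<sigma> \<tau> \<delta> \<longleftrightarrow>
    module_hom gr_scale gr_scale \<delta> \<and> (\<forall>a c. \<delta> (a * c) = \<delta> a * \<tau> c + \<sigma> a * \<delta> c)"

definition ring_units :: "'a::comm_ring_1 set"
  where "ring_units = {u. u dvd 1}"

text \<open>Multiplicative inverse; meaningful only on \<open>ring_units\<close>.\<close>
definition unit_inverse :: "'a::comm_ring_1 \<Rightarrow> 'a"
  where "unit_inverse u = (THE v. u * v = 1)"

lemma unit_inverse:
  assumes "u \<in> ring_units"
  shows "u * unit_inverse u = 1"
proof -
  obtain v where v: "u * v = 1"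
    using assms by (auto simp: ring_units_def dvd_def)
  have "w = v" if "u * w = 1" for w
    by (metis v that mult.assoc mult.commute mult_1_right)
  with v show ?thesis
    unfolding unit_inverse_def by (rule theI)
qed

definition p_torsion :: "nat \<Rightarrow> 'r::comm_ring_1 \<Rightarrow> bool"
  where "p_torsion p r \<longleftrightarrow> r \<noteq> 0 \<and> of_nat p * r = 0"

definition additively_torsion_free :: "'r::comm_ring_1 itself \<Rightarrow> bool"
  where "additively_torsion_free _ \<longleftrightarrow>
    (\<forall>n>0. \<forall>r::'r. of_nat n * r = 0 \<longrightarrow> r = 0)"

text \<open>\<open>nat_multiple n g = g + \<dots> + g\<close> (\<open>n\<close> summands), the \<open>n\<close>-th power of \<open>g\<close> in multiplicative notation.\<close>
definition nat_multiple :: "nat \<Rightarrow> 'g::ab_group_add \<Rightarrow> 'g"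
  where "nat_multiple n g = ((+) g ^^ n) 0"

definition finite_order :: "'g::ab_group_add \<Rightarrow> bool"
  where "finite_order g \<longleftrightarrow> (\<exists>n>0. nat_multiple n g = 0)"

text \<open>Meaningful only for elements of finite order.\<close>
definition elem_order :: "'g::ab_group_add \<Rightarrow> nat"
  where "elem_order g = (LEAST n. n > 0 \<and> nat_multiple n g = 0)"

text \<open>An infinite order counts as not divisible by \<open>p\<close>.\<close>
definition divides_order :: "nat \<Rightarrow> 'g::ab_group_add \<Rightarrow> bool"
  where "divides_order p g \<longleftrightarrow> finite_order g \<and> p dvd elem_order g"

definition torsion_condition :: "'r::comm_ring_1 itself \<Rightarrow> 'g::ab_group_add itself \<Rightarrow> bool"
  where "torsion_condition R G \<longleftrightarrow>
    additively_torsion_free R \<or>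
    (\<forall>p. prime p \<and> (\<exists>r::'r. p_torsion p r) \<longrightarrow> (\<forall>g::'g. \<not> divides_order p g))"

end

theory Submission
  imports Defs
begin

text \<open>The group ring of an abelian group over a commutative ring is commutative, so a product
  \<open>a * c\<close> has two Leibniz expansions, one for each order of the factors. Equating them
  gives \<open>twisted_derivation_exchange\<close>, which ties the value of \<delta> at any
  \<open>a\<close> to its value at any \<open>c\<close>. With \<open>c\<close> taken to be
  \<open>b\<close>, the factor multiplying \<open>\<delta> a\<close> is a unit, and dividing by it
  leaves a formula in which \<delta> enters only through \<open>\<delta> b\<close>.\<close>

lemma twisted_derivation_exchange:
  assumes "twisted_derivation \<sigma> \<tau> \<delta>"
  shows "(\<tau> c - \<sigma> c) * \<delta> a = \<delta> c * (\<tau> a - \<sigma> a)"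
proof -
  have leibniz: "\<delta> (x * y) = \<delta> x * \<tau> y + \<sigma> x * \<delta> y" for x y
    using assms by (simp add: twisted_derivation_def)
  \<comment> \<open>The four terms are regrouped so that each bracket is a Leibniz expansion, of
    \<open>a * c\<close> and of \<open>c * a\<close> respectively.\<close>
  have "(\<tau> c - \<sigma> c) * \<delta> a - \<delta> c * (\<tau> a - \<sigma> a)
      = (\<delta> a * \<tau> c + \<sigma> a * \<delta> c) - (\<delta> c * \<tau> a + \<sigma> c * \<delta> a)"
    by (simp add: algebra_simps)
  also have "\<dots> = \<delta> (a * c) - \<delta> (c * a)"
    by (simp only: leibniz)
  also have "\<dots> = 0"
    by (simp only: mult.commute[of a c] diff_self)
  finally show ?thesis
    by (simp only: right_minus_eq)
qed

theorem theorem4p6: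
  fixes \<sigma> \<tau> :: "('r::comm_ring_1, 'g::ab_group_add) group_ring \<Rightarrow> ('r, 'g) group_ring"
    and b :: "('r, 'g) group_ring"
  assumes "torsion_condition TYPE('r) TYPE('g)"
    and "gr_algebra_endo \<sigma>" and "gr_algebra_endo \<tau>" and "\<sigma> \<noteq> \<tau>"
    and "\<tau> b - \<sigma> b \<in> ring_units"
  shows "\<forall>\<delta>. twisted_derivation \<sigma> \<tau> \<delta> \<longrightarrow>
    (\<forall>a. \<delta> a = unit_inverse (\<tau> b - \<sigma> b) * \<delta> b * (\<tau> a - \<sigma> a))"
proof (intro allI impI)
  fix \<delta> a
  assume "twisted_derivation \<sigma> \<tau> \<delta>"
  then have exchange: "(\<tau> b - \<sigma> b) * \<delta> a = \<delta> b * (\<tau> a - \<sigma> a)"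
    by (rule twisted_derivation_exchange)
  \<comment> \<open>A factor 1 is inserted as the unit times its inverse;
    \<open>unit_inverse\<close> is a definite description, so this is where membership in
    \<open>ring_units\<close> enters. Regrouping then exposes the left side of
    \<open>exchange\<close>.\<close>
  have "\<delta> a = (\<tau> b - \<sigma> b) * unit_inverse (\<tau> b - \<sigma> b) * \<delta> a"
    by (simp only: unit_inverse[OF assms(5)] mult_1_left)
  also have "\<dots> = unit_inverse (\<tau> b - \<sigma> b) * ((\<tau> b - \<sigma> b) * \<delta> a)"
    by (simp only: ac_simps)
  finally show "\<delta> a = unit_inverse (\<tau> b - \<sigma> b) * \<delta> b * (\<tau> a - \<sigma> a)"
    by (simp only: exchange mult.assoc)
qed

end
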